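(* Let $t\ge1$ and let $A_1,A_2,\dots,A_t$ be deterministic online graph coloring algorithms, each of which may or may not make use of the predictions. Then there exists a deterministic online graph coloring algorithm $A$ (which may use the predictions) such that for every online graph with predictions $(G,\pi,P)$, $$A(G)\le t\cdot\min_{1\le i\le t}A_i(G).$$
   Context: An online graph with predictions $(G,\pi,P)$ consists of a finite graph $G=(V,E)$, an ordering $\pi=v_1,\dots,v_n$ of $V$ in which vertices are revealed one by one, and a map $P:V\to\mathcal{U}$ giving a predicted color for each vertex, revealed with it; $\mathcal{U}$ is an infinite universe of colors. An online coloring algorithm assigns to $v_i$, upon its arrival, a color from $\mathcal{U}$ depending only on the subgraph induced by $v_1,\dots,v_i$, the predictions $P(v_1),\dots,P(v_i)$ (if it uses predictions) and the colors already assigned to $v_1,\dots,v_{i-1}$; the assignment is irrevocable and the resulting coloring must be proper. For an algorithm $B$, $B(G)$ denotes the number of distinct colors $B$ uses on $(G,\pi,P)$. *)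

theory Defs
  imports "Graph_Theory.Digraph_Component"
begin

text \<open>
  A finite simple graph is a \<open>pair_graph\<close>: finite, loop-free, with a symmetric arc relation.
  The universe of colors is the whole type \<open>'c\<close>, which the theorem assumes to be infinite.
\<close>

definition online_graph_with_predictions ::
  "'v pair_pre_digraph \<Rightarrow> 'v list \<Rightarrow> ('v \<Rightarrow> 'c) \<Rightarrow> bool" where
  "online_graph_with_predictions G \<pi> P \<longleftrightarrow>
     pair_graph G \<and> distinct \<pi> \<and> set \<pi> = pverts G"

text \<open>
  The arguments of a deterministic algorithm, when \<open>v\<^sub>i\<close> arrives, are the subgraph induced by
  \<open>v\<^sub>1, \<dots>, v\<^sub>i\<close>, the list \<open>v\<^sub>1, \<dots>, v\<^sub>i\<close>, the list of their predictions, and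
  the list of the colors already assigned to \<open>v\<^sub>1, \<dots>, v\<^sub>i\<^sub>-\<^sub>1\<close>. An algorithm that does
  not use predictions is one that ignores its third argument.
\<close>

type_synonym ('v, 'c) online_alg =
  "('v, 'v \<times> 'v) pre_digraph \<Rightarrow> 'v list \<Rightarrow> 'c list \<Rightarrow> 'c list \<Rightarrow> 'c"

primrec colors_upto ::
  "('v, 'c) online_alg \<Rightarrow> 'v pair_pre_digraph \<Rightarrow> 'v list \<Rightarrow> ('v \<Rightarrow> 'c) \<Rightarrow> nat \<Rightarrow> 'c list" where
  "colors_upto A G \<pi> P 0 = []"
| "colors_upto A G \<pi> P (Suc i) =
     (let vs = take (Suc i) \<pi>; cs = colors_upto A G \<pi> P i
      in cs @ [A (with_proj G \<restriction> set vs) vs (map P vs) cs])"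

definition online_colors ::
  "('v, 'c) online_alg \<Rightarrow> 'v pair_pre_digraph \<Rightarrow> 'v list \<Rightarrow> ('v \<Rightarrow> 'c) \<Rightarrow> 'c list" where
  "online_colors A G \<pi> P = colors_upto A G \<pi> P (length \<pi>)"

definition proper_colors :: "'v pair_pre_digraph \<Rightarrow> 'v list \<Rightarrow> 'c list \<Rightarrow> bool" where
  "proper_colors G \<pi> cs \<longleftrightarrow>
     (\<forall>i < length \<pi>. \<forall>j < length \<pi>. (\<pi> ! i, \<pi> ! j) \<in> parcs G \<longrightarrow> cs ! i \<noteq> cs ! j)"

definition online_coloring_algorithm :: "('v, 'c) online_alg \<Rightarrow> bool" where
  "online_coloring_algorithm A \<longleftrightarrow>
     (\<forall>G \<pi> P. online_graph_with_predictions G \<pi> P \<longrightarrow>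
        proper_colors G \<pi> (online_colors A G \<pi> P))"

definition num_colors ::
  "('v, 'c) online_alg \<Rightarrow> 'v pair_pre_digraph \<Rightarrow> 'v list \<Rightarrow> ('v \<Rightarrow> 'c) \<Rightarrow> nat" where
  "num_colors A G \<pi> P = card (set (online_colors A G \<pi> P))"

end

theory Submission
  imports Defs
begin

text \<open>
  The combined algorithm simulates all \<open>A\<^sub>i\<close> and colors each arriving vertex with the pair
  \<open>(i, c)\<close>, where \<open>A\<^sub>i\<close> is the algorithm that has used fewest colors so far and \<open>c\<close> is the color
  it gives to the vertex; infinitude of the universe allows such pairs to be encoded as colors.
  Pairs with different first components differ, and pairs with the same first component inherit
  properness from \<open>A\<^sub>i\<close>. Let \<open>m\<close> be the final minimum. Whenever \<open>A\<^sub>i\<close> is selected, it has used at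
  most \<open>m\<close> colors so far, so the pairs with first component \<open>i\<close> only involve
  the colors \<open>A\<^sub>i\<close> had used when it was last selected, which are at most \<open>m\<close> many.
\<close>

lemma length_colors_upto [simp]: "length (colors_upto A G \<pi> P k) = k"
  by (induction k) (simp_all add: Let_def)

lemma take_colors_upto:
  "j \<le> k \<Longrightarrow> take j (colors_upto A G \<pi> P k) = colors_upto A G \<pi> P j"
  by (induction k) (auto simp: Let_def le_Suc_eq)

lemma length_online_colors [simp]: "length (online_colors A G \<pi> P) = length \<pi>"
  by (simp add: online_colors_def)

lemma take_online_colors:
  "k \<le> length \<pi> \<Longrightarrow> take k (online_colors A G \<pi> P) = colors_upto A G \<pi> P k"
  by (simp add: online_colors_def take_colors_upto)

lemma nth_colors_upto:
  assumes "i < k"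
  shows "colors_upto A G \<pi> P k ! i =
    A (with_proj G \<restriction> set (take (Suc i) \<pi>)) (take (Suc i) \<pi>) (map P (take (Suc i) \<pi>))
      (colors_upto A G \<pi> P i)"
proof -
  have "colors_upto A G \<pi> P k ! i = take (Suc i) (colors_upto A G \<pi> P k) ! i"
    by simp
  also have "\<dots> = colors_upto A G \<pi> P (Suc i) ! i"
    using assms by (subst take_colors_upto) auto
  finally show ?thesis
    by (simp add: Let_def nth_append)
qed

text \<open>An algorithm receives a \<open>pre_digraph\<close>, but running another algorithm takes
  a \<open>pair_pre_digraph\<close>. On subgraphs of \<open>with_proj G\<close> tail and head are
  the projections, so nothing is lost.\<close>

definition pair_of :: "('v, 'v \<times> 'v) pre_digraph \<Rightarrow> 'v pair_pre_digraph" where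
  "pair_of H = \<lparr>pverts = verts H, parcs = arcs H\<rparr>"

lemma induce_pair_of_induce:
  assumes "V \<subseteq> W"
  shows "with_proj (pair_of (with_proj G \<restriction> W)) \<restriction> V = with_proj G \<restriction> V"
  using assms by (auto simp: pair_of_def induce_subgraph_def)

text \<open>This is what makes simulation possible online: the first \<open>j\<close> colors depend
  only on what the first \<open>j\<close> vertices reveal, and inducing twice equals inducing on the
  smaller set.\<close>

lemma colors_upto_prefix:
  assumes "j \<le> k" "\<And>v. v \<in> set (take k \<pi>) \<Longrightarrow> P' v = P v"
  shows "colors_upto A (pair_of (with_proj G \<restriction> set (take k \<pi>))) (take k \<pi>) P' j =
    colors_upto A G \<pi> P j"
  using assms(1)
proof (induction j)
  case (Suc j)
  have sub: "set (take (Suc j) \<pi>) \<subseteq> set (take k \<pi>)"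
    using Suc.prems by (rule set_take_subset_set_take)
  have preds: "map P' (take (Suc j) \<pi>) = map P (take (Suc j) \<pi>)"
    using sub assms(2) by auto
  show ?case
    using Suc by (simp add: Let_def min_absorb1 preds induce_pair_of_induce[OF sub]
        del: map_eq_conv)
qed simp

text \<open>The lookup turns the list of predictions back into a map; its unspecified values outside
  \<open>vs\<close> are never consulted.\<close>

definition simulate ::
  "('v, 'c) online_alg \<Rightarrow> ('v, 'v \<times> 'v) pre_digraph \<Rightarrow> 'v list \<Rightarrow> 'c list \<Rightarrow> 'c list" where
  "simulate A H vs ps = online_colors A (pair_of H) vs (\<lambda>v. the (map_of (zip vs ps) v))"

lemma simulate_prefix:
  assumes "k \<le> length \<pi>"
  shows "simulate A (with_proj G \<restriction> set (take k \<pi>)) (take k \<pi>) (map P (take k \<pi>)) =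
    colors_upto A G \<pi> P k"
  using assms unfolding simulate_def online_colors_def
  by (subst length_take, subst min_absorb2, assumption, subst colors_upto_prefix)
    (simp_all add: map_of_zip_map)

text \<open>Each simulation rebuilds its own history, since \<open>cs\<close> records the combined
  colors and not those of \<open>As i\<close>. The counts already include the arriving vertex, whose
  simulated color is the \<open>last\<close> one.\<close>

definition combine ::
  "(nat \<times> 'c \<Rightarrow> 'c) \<Rightarrow> nat set \<Rightarrow> (nat \<Rightarrow> ('v, 'c) online_alg) \<Rightarrow> ('v, 'c) online_alg" where
  "combine e I As H vs ps cs =
     (let i = arg_min_on (\<lambda>i. card (set (simulate (As i) H vs ps))) I
      in e (i, last (simulate (As i) H vs ps)))"

text \<open>The index that \<open>combine\<close> selects at the 0-based position \<open>k\<close>,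
  expressed by runs on the whole of \<open>G\<close>; hence \<open>Suc k\<close> vertices are
  counted.\<close>

definition best_index ::
  "nat set \<Rightarrow> (nat \<Rightarrow> ('v, 'c) online_alg) \<Rightarrow> 'v pair_pre_digraph \<Rightarrow> 'v list \<Rightarrow> ('v \<Rightarrow> 'c) \<Rightarrow>
    nat \<Rightarrow> nat" where
  "best_index I As G \<pi> P k = arg_min_on (\<lambda>i. card (set (colors_upto (As i) G \<pi> P (Suc k)))) I"

lemma nth_online_colors_combine:
  assumes "k < length \<pi>"
  shows "online_colors (combine e I As) G \<pi> P ! k =
    e (best_index I As G \<pi> P k, online_colors (As (best_index I As G \<pi> P k)) G \<pi> P ! k)"
proof -
  have "online_colors (combine e I As) G \<pi> P ! k =
      e (best_index I As G \<pi> P k, last (colors_upto (As (best_index I As G \<pi> P k)) G \<pi> P (Suc k)))"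
    unfolding online_colors_def nth_colors_upto[OF assms] combine_def
    using assms by (simp add: simulate_prefix best_index_def Let_def del: colors_upto.simps)
  also have "\<dots> =
      e (best_index I As G \<pi> P k, online_colors (As (best_index I As G \<pi> P k)) G \<pi> P ! k)"
    using assms by (simp add: Let_def online_colors_def nth_colors_upto)
  finally show ?thesis .
qed

lemma best_index_in:
  "finite I \<Longrightarrow> I \<noteq> {} \<Longrightarrow> best_index I As G \<pi> P k \<in> I"
  unfolding best_index_def by (rule arg_min_if_finite(1))

text \<open>The selected index is minimal at time \<open>k\<close>, and the colors
  \<open>As i\<close> has used by then are among those of its full run.\<close>

lemma card_best_index_le_num_colors:
  assumes "finite I" "i \<in> I" "k < length \<pi>"
  shows "card (set (colors_upto (As (best_index I As G \<pi> P k)) G \<pi> P (Suc k)))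
    \<le> num_colors (As i) G \<pi> P"
proof -
  have "card (set (colors_upto (As (best_index I As G \<pi> P k)) G \<pi> P (Suc k)))
      \<le> card (set (colors_upto (As i) G \<pi> P (Suc k)))"
    unfolding best_index_def using assms by (intro arg_min_least) auto
  also have "\<dots> \<le> num_colors (As i) G \<pi> P"
    unfolding num_colors_def using assms(3)
    by (subst take_online_colors[symmetric]) (auto intro!: card_mono dest: in_set_takeD)
  finally show ?thesis .
qed

lemma online_coloring_algorithm_combine:
  assumes "inj_on e (I \<times> UNIV)" "finite I" "I \<noteq> {}"
    and "\<And>i. i \<in> I \<Longrightarrow> online_coloring_algorithm (As i)"
  shows "online_coloring_algorithm (combine e I As)"
  unfolding online_coloring_algorithm_def proper_colors_def
proof (intro allI impI notI)
  fix G \<pi> P i j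
  assume G: "online_graph_with_predictions G \<pi> P" and ij: "i < length \<pi>" "j < length \<pi>"
    and arc: "(\<pi> ! i, \<pi> ! j) \<in> parcs G"
    and eq: "online_colors (combine e I As) G \<pi> P ! i = online_colors (combine e I As) G \<pi> P ! j"
  define b where "b = best_index I As G \<pi> P"
  \<comment> \<open>Pairs can be decoded only on \<open>I \<times> UNIV\<close>, where
    \<open>e\<close> is injective.\<close>
  have bI: "b k \<in> I" for k
    unfolding b_def using assms(2,3) by (rule best_index_in)
  have "e (b i, online_colors (As (b i)) G \<pi> P ! i) = e (b j, online_colors (As (b j)) G \<pi> P ! j)"
    using eq ij by (simp add: nth_online_colors_combine b_def)
  then have "b i = b j" "online_colors (As (b i)) G \<pi> P ! i = online_colors (As (b j)) G \<pi> P ! j"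
    using inj_onD[OF assms(1)] bI by fastforce+
  moreover have "proper_colors G \<pi> (online_colors (As (b i)) G \<pi> P)"
    using assms(4)[OF bI] G by (simp add: online_coloring_algorithm_def)
  ultimately show False
    using ij arc by (auto simp: proper_colors_def)
qed

lemma num_colors_combine_le:
  assumes "finite I" "i \<in> I"
  shows "num_colors (combine e I As) G \<pi> P \<le> card I * num_colors (As i) G \<pi> P"
proof -
  define b where "b = best_index I As G \<pi> P"
  define m where "m = num_colors (As i) G \<pi> P"
  \<comment> \<open>The second components of the pairs used with first component
    \<open>j\<close>.\<close>
  define C where "C j = {online_colors (As j) G \<pi> P ! k |k. k < length \<pi> \<and> b k = j}" for j
  have fin: "finite (C j)" for j
    by (simp add: C_def)
  have card_C: "card (C j) \<le> m" for j
  proof (cases "C j = {}")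
    case False
    define K where "K = {k. k < length \<pi> \<and> b k = j}"
    have K: "finite K" "K \<noteq> {}"
      using False by (auto simp: K_def C_def)
    then have MaxK: "Max K < length \<pi>" "b (Max K) = j"
      using Max_in[OF K] by (auto simp: K_def)
    \<comment> \<open>\<open>Max K\<close> is the last time \<open>j\<close> is selected, so every
      color in \<open>C j\<close> occurs in the run of \<open>As j\<close> up to and including that
      position.\<close>
    have "C j \<subseteq> set (colors_upto (As j) G \<pi> P (Suc (Max K)))"
    proof
      fix c assume "c \<in> C j"
      then obtain k where k: "k \<in> K" "c = online_colors (As j) G \<pi> P ! k"
        by (auto simp: C_def K_def)
      have le: "k \<le> Max K"
        using K k by simp
      then have "c = take (Suc (Max K)) (online_colors (As j) G \<pi> P) ! k"
        using k by simp
      also have "\<dots> = colors_upto (As j) G \<pi> P (Suc (Max K)) ! k"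
        using MaxK by (subst take_online_colors) auto
      finally show "c \<in> set (colors_upto (As j) G \<pi> P (Suc (Max K)))"
        using le by (metis length_colors_upto less_Suc_eq_le nth_mem)
    qed
    then have "card (C j) \<le> card (set (colors_upto (As j) G \<pi> P (Suc (Max K))))"
      by (intro card_mono) auto
    also have "\<dots> \<le> m"
      using card_best_index_le_num_colors[OF assms MaxK(1), of As G P] MaxK(2)
      unfolding m_def b_def by simp
    finally show ?thesis .
  qed simp
  have sub: "set (online_colors (combine e I As) G \<pi> P) \<subseteq> e ` Sigma I C"
  proof
    fix c assume "c \<in> set (online_colors (combine e I As) G \<pi> P)"
    then obtain k where k: "k < length \<pi>" "c = online_colors (combine e I As) G \<pi> P ! k"
      by (auto simp: in_set_conv_nth)
    moreover have "b k \<in> I"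
      unfolding b_def using assms by (intro best_index_in) auto
    ultimately show "c \<in> e ` Sigma I C"
      by (force simp: nth_online_colors_combine b_def C_def)
  qed
  have "num_colors (combine e I As) G \<pi> P \<le> card (e ` Sigma I C)"
    unfolding num_colors_def using assms(1) fin sub by (intro card_mono) auto
  also have "\<dots> \<le> card (Sigma I C)"
    using assms(1) fin by (intro card_image_le) auto
  also have "\<dots> = (\<Sum>j\<in>I. card (C j))"
    using assms(1) fin by (intro card_SigmaI) auto
  also have "\<dots> \<le> card I * m"
    using sum_bounded_above[of I "\<lambda>j. card (C j)" m] card_C by simp
  finally show ?thesis
    by (simp add: m_def)
qed

text \<open>Supplies the encoding of pairs. A nonempty factor of cardinality at most that of an
  infinite set is absorbed in the product, whatever the infinite cardinality.\<close>

lemma infinite_absorbs_finite_product: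
  assumes "infinite (UNIV :: 'c set)" "finite I"
  shows "\<exists>e :: 'i \<times> 'c \<Rightarrow> 'c. inj_on e (I \<times> UNIV)"
proof (cases "I = {}")
  case False
  have "(card_of I, card_of (UNIV :: 'c set)) \<in> ordLeq"
    using assms by (intro ordLess_imp_ordLeq finite_ordLess_infinite)
      (simp_all add: Field_card_of card_of_well_order_on)
  then have "(card_of (I \<times> (UNIV :: 'c set)), card_of (UNIV :: 'c set)) \<in> ordIso"
    using card_of_Times_infinite[OF assms(1) False] by simp
  then show ?thesis
    using card_of_ordIso[of "I \<times> (UNIV :: 'c set)" "UNIV :: 'c set"] bij_betw_imp_inj_on by blast
qed simp

theorem theorem3:
  fixes t :: nat and As :: "nat \<Rightarrow> ('v, 'c) online_alg"
  assumes "infinite (UNIV :: 'c set)"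
    and "t \<ge> 1"
    and "\<And>i. i \<in> {1..t} \<Longrightarrow> online_coloring_algorithm (As i)"
  shows "\<exists>A :: ('v, 'c) online_alg. online_coloring_algorithm A \<and>
           (\<forall>G \<pi> P. online_graph_with_predictions G \<pi> P \<longrightarrow>
              num_colors A G \<pi> P \<le> t * (MIN i\<in>{1..t}. num_colors (As i) G \<pi> P))"
proof -
  obtain e :: "nat \<times> 'c \<Rightarrow> 'c" where e: "inj_on e ({1..t} \<times> UNIV)"
    using infinite_absorbs_finite_product[OF assms(1), of "{1..t}"] by auto
  have "online_coloring_algorithm (combine e {1..t} As)"
    using e assms by (intro online_coloring_algorithm_combine) auto
  moreover have "num_colors (combine e {1..t} As) G \<pi> P
      \<le> t * (MIN i\<in>{1..t}. num_colors (As i) G \<pi> P)" for G \<pi> P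
  proof -
    \<comment> \<open>As \<open>t \<ge> 1\<close>, the minimum is attained at some \<open>i\<close>,
      and the bound against that single competitor suffices.\<close>
    have "(MIN i\<in>{1..t}. num_colors (As i) G \<pi> P) \<in> (\<lambda>i. num_colors (As i) G \<pi> P) ` {1..t}"
      using assms(2) by (intro Min_in) auto
    then obtain i where "i \<in> {1..t}"
      and "(MIN i\<in>{1..t}. num_colors (As i) G \<pi> P) = num_colors (As i) G \<pi> P"
      by blast
    then show ?thesis
      using num_colors_combine_le[of "{1..t}" i e As G \<pi> P] by simp
  qed
  ultimately show ?thesis
    by blast
qed

end
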